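(* Let $M$ be a smooth manifold and let $\{X_t\}_{t\ge 0}$ be an $M$-valued diffusion with infinitesimal generator $L$, with $P_x(X_t\in M)=1$ for all $x\in M$ and $t\ge 0$ (stochastic completeness). Let $\mu_t^x(E)=P_x(X_t\in E)$ be its heat kernel measures, and assume that for every $t\geq 0$ and every Borel set $E\subset M$ the map $x\mapsto \mu_t^x(E)$ is measurable. Fix $o\in M$, $0\le t<T$ and $1\le p\le\infty$. If $f\in L^p(M,\mu_T^o)$, then the integral $$(e^{tL}f)(x):=\int_M f(y)\,\mu_t^x(dy)$$ is absolutely convergent for $\mu_{T-t}^o$-almost every $x\in M$. Furthermore, $e^{tL}$ is a contraction from $L^p(M,\mu_T^o)$ to $L^p(M,\mu_{T-t}^o)$; that is, $f\mapsto e^{tL}f$ is a well-defined linear map between these spaces (of equivalence classes) and $\|e^{tL}f\|_{L^p(M,\mu_{T-t}^o)}\le \|f\|_{L^p(M,\mu_T^o)}$.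
   Context: An $M$-valued diffusion $\{X_t\}_{t\ge0}$ is a time-homogeneous strong Markov process with continuous sample paths such that for every $f\in C^2(M)$ the process $f(X_t)-\int_0^t (Lf)(X_s)\,ds$ is a local martingale; $L$ is its infinitesimal generator. $P_x$ denotes probability conditioned on $X_0=x$ a.s. The measures $\mu_t^x$ are Borel probability measures on $M$ satisfying the Markov (semigroup) property $\int_M \mu_t^x(E)\,\mu_s^o(dx)=\mu_{s+t}^o(E)$, with $\mu_0^x=\delta_x$. The operator $e^{tL}$ is defined by the displayed integral, not as a power series in $L$. *)

theory Defs
  imports "HOL-Probability.Probability"
begin

section \<open>Smooth manifolds\<close>

text \<open>
  \<open>Ck_on k S f\<close> is used for open \<open>S\<close> in a finite-dimensional space only; there, continuity of all
  iterated directional derivatives up to order \<open>k\<close> is the usual \<open>C\<^sup>k\<close> condition.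
\<close>

primrec Ck_on ::
  "nat \<Rightarrow> 'e::real_normed_vector set \<Rightarrow> ('e \<Rightarrow> 'f::real_normed_vector) \<Rightarrow> bool" where
  "Ck_on 0 S f = continuous_on S f"
| "Ck_on (Suc k) S f =
     ((\<forall>x\<in>S. f differentiable at x) \<and> (\<forall>v. Ck_on k S (\<lambda>x. frechet_derivative f (at x) v)))"

definition smooth_on :: "'e::real_normed_vector set \<Rightarrow> ('e \<Rightarrow> 'f::real_normed_vector) \<Rightarrow> bool" where
  "smooth_on S f \<longleftrightarrow> (\<forall>k. Ck_on k S f)"

type_synonym ('m, 'e) chart = "'m set \<times> ('m \<Rightarrow> 'e)"

text \<open>
  The manifold is the whole type \<open>'m\<close>, its Hausdorff and second countability axioms being the type
  classes. The model space is a finite-dimensional normed space rather than an instance of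
  \<open>euclidean_space\<close>, because the latter class excludes dimension zero.
\<close>

locale smooth_manifold =
  fixes atlas :: "('m::{t2_space,second_countable_topology}, 'e::real_normed_vector) chart set"
  assumes finite_dimensional: "\<exists>B::'e set. finite B \<and> span B = UNIV"
    and covers: "(\<Union>(U, \<phi>)\<in>atlas. U) = UNIV"
    and charts: "(U, \<phi>) \<in> atlas \<Longrightarrow>
      open U \<and> open (\<phi> ` U) \<and> (\<exists>\<psi>. homeomorphism U (\<phi> ` U) \<phi> \<psi>)"
    and compatible: "(U, \<phi>) \<in> atlas \<Longrightarrow> (V, \<psi>) \<in> atlas \<Longrightarrow>
      smooth_on (\<phi> ` (U \<inter> V)) (\<psi> \<circ> inv_into U \<phi>)"

definition C2_functions :: "('m, 'e::real_normed_vector) chart set \<Rightarrow> ('m \<Rightarrow> real) set" where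
  "C2_functions atlas = {f. \<forall>(U, \<phi>)\<in>atlas. Ck_on 2 (\<phi> ` U) (f \<circ> inv_into U \<phi>)}"

section \<open>Martingales\<close>

text \<open>
  Filtrations are indexed by \<open>[0,\<infinity>]\<close> (type \<open>ennreal\<close>), so that the library's stopping times may take
  the value \<open>\<infinity>\<close>; processes are indexed by real times, of which only those \<open>\<ge> 0\<close> matter.
\<close>

definition martingale ::
  "'w measure \<Rightarrow> (ennreal \<Rightarrow> 'w measure) \<Rightarrow> (real \<Rightarrow> 'w \<Rightarrow> real) \<Rightarrow> bool" where
  "martingale P F Y \<longleftrightarrow>
     (\<forall>t\<ge>0. Y t \<in> borel_measurable (F (ennreal t)) \<and> integrable P (Y t)) \<and>
     (\<forall>s t. 0 \<le> s \<and> s \<le> t \<longrightarrow> (AE \<omega> in P. real_cond_exp P (F (ennreal s)) (Y t) \<omega> = Y s \<omega>))"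

text \<open>
  Local martingales on the stochastic interval \<open>[0,\<zeta>)\<close>. For \<open>\<zeta> = \<infinity>\<close> the condition
  \<open>\<tau> n \<omega> < \<zeta> \<omega>\<close> is void and this is the usual notion on \<open>[0,\<infinity>)\<close>.
\<close>

definition local_martingale_until ::
  "'w measure \<Rightarrow> (ennreal \<Rightarrow> 'w measure) \<Rightarrow> ('w \<Rightarrow> ennreal) \<Rightarrow> (real \<Rightarrow> 'w \<Rightarrow> real) \<Rightarrow> bool" where
  "local_martingale_until P F \<zeta> Y \<longleftrightarrow>
     (\<exists>\<tau>::nat \<Rightarrow> 'w \<Rightarrow> ennreal.
        (\<forall>n. stopping_time F (\<tau> n)) \<and>
        (AE \<omega> in P. incseq (\<lambda>n. \<tau> n \<omega>) \<and> (SUP n. \<tau> n \<omega>) = \<zeta> \<omega> \<and>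
                    (\<zeta> \<omega> < \<infinity> \<longrightarrow> (\<forall>n. \<tau> n \<omega> < \<zeta> \<omega>))) \<and>
        (\<forall>n. martingale P F (\<lambda>t \<omega>. Y (enn2real (min (ennreal t) (\<tau> n \<omega>))) \<omega>)))"

section \<open>Diffusions\<close>

text \<open>
  A diffusion may leave \<open>M\<close> in finite time. Its state space is therefore the one-point
  compactification \<open>M \<union> {\<Delta>}\<close>, realised on \<open>'m option\<close> with \<open>\<Delta> = None\<close>, an absorbing state
  (isolated if \<open>M\<close> is compact); the event \<open>X\<^sub>t \<in> M\<close> is \<open>X t \<omega> \<in> range Some\<close>. Functions on \<open>M\<close> are
  extended by \<open>0\<close> to \<open>\<Delta>\<close>. If \<open>\<Delta>\<close> is never reached, the conditions below are exactly those for
  an \<open>M\<close>-valued process with infinite lifetime.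
\<close>

abbreviation compactified :: "'m::topological_space option topology" where
  "compactified \<equiv> Alexandroff_compactification euclidean"

definition borel_compactified :: "'m::topological_space option measure" where
  "borel_compactified = sigma UNIV {U. openin compactified U}"

definition lifetime :: "(real \<Rightarrow> 'w \<Rightarrow> 'm option) \<Rightarrow> 'w \<Rightarrow> ennreal" where
  "lifetime X \<omega> = Inf {ennreal t |t. 0 \<le> t \<and> X t \<omega> = None}"

text \<open>
  In \<open>strong_markov\<close> it suffices to consider Borel sets \<open>E\<close> of \<open>M\<close> and the event that \<open>X\<^sub>\<tau> \<in> M\<close>,
  since \<open>\<Delta>\<close> is absorbing. Time-homogeneity is the fact that the right-hand side depends on \<open>s\<close> only.
\<close>

locale diffusion = smooth_manifold atlas
  for atlas :: "('m::{t2_space,second_countable_topology}, 'e::real_normed_vector) chart set" +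
  fixes L :: "('m \<Rightarrow> real) \<Rightarrow> 'm \<Rightarrow> real"
    and \<Omega> :: "'w set"
    and F :: "ennreal \<Rightarrow> 'w measure"
    and P :: "'m \<Rightarrow> 'w measure"
    and X :: "real \<Rightarrow> 'w \<Rightarrow> 'm option"
  assumes prob_space_P: "prob_space (P x)"
    and space_P: "space (P x) = \<Omega>"
    and filtration: "filtration \<Omega> F"
    and subalgebra: "subalgebra (P x) (F i)"
    and adapted: "0 \<le> t \<Longrightarrow> X t \<in> measurable (F (ennreal t)) borel_compactified"
    and initial: "AE \<omega> in P x. X 0 \<omega> = Some x"
    and continuous_paths: "\<omega> \<in> \<Omega> \<Longrightarrow>
      continuous_map (top_of_set {0..}) compactified (\<lambda>t. X t \<omega>)"
    and absorbing: "\<omega> \<in> \<Omega> \<Longrightarrow> 0 \<le> s \<Longrightarrow> s \<le> t \<Longrightarrow> X s \<omega> = None \<Longrightarrow> X t \<omega> = None"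
    and strong_markov: "stopping_time F \<tau> \<Longrightarrow> 0 \<le> s \<Longrightarrow> E \<in> sets borel \<Longrightarrow>
      AE \<omega> in P x. \<forall>y. \<tau> \<omega> < \<infinity> \<and> X (enn2real (\<tau> \<omega>)) \<omega> = Some y \<longrightarrow>
        real_cond_exp (P x) (filtration.pre_sigma \<Omega> F \<tau>)
          (indicator {\<omega>\<in>\<Omega>. \<tau> \<omega> < \<infinity> \<and> X (enn2real (\<tau> \<omega>) + s) \<omega> \<in> Some ` E}) \<omega>
        = measure (P y) {\<omega>\<in>\<Omega>. X s \<omega> \<in> Some ` E}"
    and generator_integrable: "f \<in> C2_functions atlas \<Longrightarrow>
      AE \<omega> in P x. \<forall>t\<ge>0. ennreal t < lifetime X \<omega> \<longrightarrow>
        set_integrable lborel {0..t} (\<lambda>s. case_option 0 (L f) (X s \<omega>))"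
    and generator: "f \<in> C2_functions atlas \<Longrightarrow>
      local_martingale_until (P x) F (lifetime X)
        (\<lambda>t \<omega>. case_option 0 f (X t \<omega>) -
                (LINT s:{0..t}|lborel. case_option 0 (L f) (X s \<omega>)))"

definition heat_kernel ::
  "('m::topological_space \<Rightarrow> 'w measure) \<Rightarrow> (real \<Rightarrow> 'w \<Rightarrow> 'm option) \<Rightarrow> real \<Rightarrow> 'm \<Rightarrow> 'm measure" where
  "heat_kernel P X t x =
     measure_of UNIV (sets borel)
       (\<lambda>E. emeasure (P x) {\<omega>\<in>space (P x). X t \<omega> \<in> Some ` E})"

definition heat_operator ::
  "('m::topological_space \<Rightarrow> 'w measure) \<Rightarrow> (real \<Rightarrow> 'w \<Rightarrow> 'm option) \<Rightarrow> real \<Rightarrow>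
   ('m \<Rightarrow> 'k::{banach,second_countable_topology}) \<Rightarrow> 'm \<Rightarrow> 'k" where
  "heat_operator P X t f x = (LINT y|heat_kernel P X t x. f y)"

section \<open>Lebesgue spaces\<close>

text \<open>Functions, not equivalence classes; \<open>p = \<infinity>\<close> is allowed.\<close>

definition Lp_space ::
  "ennreal \<Rightarrow> 'a measure \<Rightarrow> ('a \<Rightarrow> 'k::{real_normed_vector,second_countable_topology}) set" where
  "Lp_space p \<mu> =
     {f \<in> borel_measurable \<mu>.
        if p = \<infinity> then esssup \<mu> (\<lambda>x. ennreal (norm (f x))) < \<infinity>
        else integrable \<mu> (\<lambda>x. norm (f x) powr enn2real p)}"

definition Lp_norm :: "ennreal \<Rightarrow> 'a measure \<Rightarrow> ('a \<Rightarrow> 'k::real_normed_vector) \<Rightarrow> real" where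
  "Lp_norm p \<mu> f =
     (if p = \<infinity> then enn2real (esssup \<mu> (\<lambda>x. ennreal (norm (f x))))
      else (LINT x|\<mu>. norm (f x) powr enn2real p) powr (1 / enn2real p))"

end

theory Submission
  imports Defs
begin

text \<open>
  The Markov property at the constant time \<open>T - t\<close>, integrated over the path space, says that
  \<open>\<mu>\<^sub>T\<^sup>o\<close> is the mixture of the kernels \<open>\<mu>\<^sub>t\<^sup>x\<close> over \<open>\<mu>\<^sub>T\<^sub>-\<^sub>t\<^sup>o(dx)\<close>. A function in \<open>L\<^sup>p\<close> of the mixture is
  in \<open>L\<^sup>p\<close> of almost every component, and Jensen's inequality in each component, integrated over
  \<open>x\<close>, gives the contraction; for \<open>p = \<infinity>\<close> an almost sure bound passes to almost every component.
\<close>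

section \<open>Markov kernels acting on Lebesgue spaces\<close>

text \<open>Jensen's inequality will be applied to norms, which may vanish, so convexity is wanted
  on the whole line and not only for positive arguments. The triangle inequality and monotonicity of
  the power reduce the claim to nonnegative numbers.\<close>

lemma convex_on_abs_powr:
  assumes "1 \<le> p"
  shows "convex_on UNIV (\<lambda>x::real. \<bar>x\<bar> powr p)"
proof (rule convex_onI)
  fix u x y :: real
  assume u: "0 < u" "u < 1"
  have "\<bar>(1 - u) *\<^sub>R x + u *\<^sub>R y\<bar> \<le> (1 - u) * \<bar>x\<bar> + u * \<bar>y\<bar>"
    using u abs_triangle_ineq[of "(1 - u) * x" "u * y"] by (simp add: abs_mult)
  then have "\<bar>(1 - u) *\<^sub>R x + u *\<^sub>R y\<bar> powr p \<le> ((1 - u) * \<bar>x\<bar> + u * \<bar>y\<bar>) powr p"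
    using assms by (intro powr_mono2) auto
  also have "\<dots> \<le> (1 - u) * \<bar>x\<bar> powr p + u * \<bar>y\<bar> powr p"
  \<comment> \<open>If one endpoint is zero, only \<open>v powr p \<le> v\<close> for a weight
    \<open>v\<close> strictly between 0 and 1 is at stake; otherwise both absolute values are
    positive and \<open>powr_convex\<close> applies.\<close>
  proof (cases "x = 0 \<or> y = 0")
    case True
    have "v powr p \<le> v" if "0 < v" "v < 1" for v :: real
      using powr_mono'[OF assms, of v] that by simp
    from this[of u] this[of "1 - u"] show ?thesis
      using True u by (auto simp: powr_mult intro!: mult_right_mono)
  next
    case False
    then show ?thesis
      using convex_onD[OF powr_convex[OF assms], of u "\<bar>x\<bar>" "\<bar>y\<bar>"] u by simp
  qed
  finally show "\<bar>(1 - u) *\<^sub>R x + u *\<^sub>R y\<bar> powr p \<le> (1 - u) * \<bar>x\<bar> powr p + u * \<bar>y\<bar> powr p" .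
qed simp

section \<open>Jensen's inequality for Banach-valued functions\<close>

context prob_space
begin

text \<open>For \<open>r \<ge> 0\<close> one has \<open>r \<le> 1 + r powr p\<close>, and the
  constant 1 is integrable because the total mass is finite.\<close>

lemma integrable_if_norm_powr_integrable:
  fixes f :: "'a \<Rightarrow> 'b::{banach,second_countable_topology}"
  assumes [measurable]: "f \<in> borel_measurable M"
    and "1 \<le> p" and "integrable M (\<lambda>x. norm (f x) powr p)"
  shows "integrable M f"
proof (rule Bochner_Integration.integrable_bound)
  show "integrable M (\<lambda>x. 1 + norm (f x) powr p)"
    using assms(3) by simp
  have "norm (f x) \<le> 1 + norm (f x) powr p" for x
  proof (cases "norm (f x) \<le> 1")
    case False
    then show ?thesis
      using powr_mono[of 1 p "norm (f x)"] assms(2) by simp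
  qed (simp add: add_increasing2)
  then show "AE x in M. norm (f x) \<le> norm (1 + norm (f x) powr p)"
    by (simp add: abs_of_nonneg)
qed simp

text \<open>The values are vectors, so the norm is first pulled inside the integral; Jensen's
  inequality is then applied to the real function \<open>norm (f x)\<close>.\<close>

lemma norm_integral_powr_le:
  fixes f :: "'a \<Rightarrow> 'b::{banach,second_countable_topology}"
  assumes [measurable]: "f \<in> borel_measurable M"
    and p: "1 \<le> p" and int: "integrable M (\<lambda>x. norm (f x) powr p)"
  shows "norm (\<integral>x. f x \<partial>M) powr p \<le> (\<integral>x. norm (f x) powr p \<partial>M)"
proof -
  have "integrable M f"
    using assms by (rule integrable_if_norm_powr_integrable)
  have "norm (\<integral>x. f x \<partial>M) powr p \<le> (\<integral>x. norm (f x) \<partial>M) powr p"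
    using p by (intro powr_mono2) auto
  also have "\<dots> = \<bar>\<integral>x. norm (f x) \<partial>M\<bar> powr p"
    by simp
  also have "\<dots> \<le> (\<integral>x. \<bar>norm (f x)\<bar> powr p \<partial>M)"
    using \<open>integrable M f\<close> int convex_on_abs_powr[OF p]
    by (intro jensens_inequality[where I = UNIV]) auto
  finally show ?thesis by simp
qed

end

text \<open>Abstract form of one step of the semigroup: \<open>\<nu>\<close> is the law at the
  earlier time, \<open>K\<close> the transition kernel, and \<open>\<nu> \<bind> K\<close> the law
  at the later time. Membership in \<open>prob_algebra N\<close> packs measurability in
  \<open>x\<close> together with each \<open>K x\<close> being a probability measure.\<close>

locale markov_kernel_on = prob_space \<nu> for \<nu> :: "'a measure" +
  fixes K :: "'a \<Rightarrow> 'b measure" and N :: "'b measure"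
  assumes K: "K \<in> \<nu> \<rightarrow>\<^sub>M prob_algebra N"
begin

lemma K_subprob[measurable]: "K \<in> \<nu> \<rightarrow>\<^sub>M subprob_algebra N"
  using K by (rule measurable_prob_algebraD)

lemma prob_space_K: "x \<in> space \<nu> \<Longrightarrow> prob_space (K x)"
  using measurable_space[OF K] by (simp add: space_prob_algebra)

lemma sets_K: "x \<in> space \<nu> \<Longrightarrow> sets (K x) = sets N"
  using measurable_space[OF K] by (simp add: space_prob_algebra)

lemma sets_bind_K[measurable_cong]: "sets (\<nu> \<bind> K) = sets N"
  by (rule sets_bind[OF sets_K not_empty])

lemma AE_bind_K:
  "Measurable.pred N Q \<Longrightarrow> (AE y in \<nu> \<bind> K. Q y) \<longleftrightarrow> (AE x in \<nu>. AE y in K x. Q y)"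
  by (rule AE_bind[OF K_subprob])

lemma integral_K_measurable[measurable]:
  fixes f :: "'b \<Rightarrow> 'k::{banach,second_countable_topology}"
  assumes "f \<in> borel_measurable N"
  shows "(\<lambda>x. \<integral>y. f y \<partial>K x) \<in> borel_measurable \<nu>"
  using assms by measurable

text \<open>Integrating against the mixture is iterated integration. Hence the inner integrals of
  \<open>norm (f y) powr p\<close> are finite for almost every \<open>x\<close>, and Jensen's
  inequality under each such \<open>K x\<close> can be integrated over \<open>\<nu>\<close>.\<close>

lemma Lp_finite:
  fixes f :: "'b \<Rightarrow> 'k::{banach,second_countable_topology}"
  assumes [measurable]: "f \<in> borel_measurable N"
    and p: "1 \<le> p" and int: "integrable (\<nu> \<bind> K) (\<lambda>y. norm (f y) powr p)"
  shows "AE x in \<nu>. integrable (K x) f"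
    and "integrable \<nu> (\<lambda>x. norm (\<integral>y. f y \<partial>K x) powr p)"
    and "(\<integral>x. norm (\<integral>y. f y \<partial>K x) powr p \<partial>\<nu>) \<le> (\<integral>y. norm (f y) powr p \<partial>(\<nu> \<bind> K))"
proof -
  let ?I = "\<lambda>x. \<integral>\<^sup>+y. ennreal (norm (f y) powr p) \<partial>K x"
  have I: "(\<integral>\<^sup>+x. ?I x \<partial>\<nu>) = ennreal (\<integral>y. norm (f y) powr p \<partial>(\<nu> \<bind> K))"
    using int by (subst nn_integral_bind[symmetric, where B = N]) (auto simp: nn_integral_eq_integral)
  have [measurable]: "?I \<in> borel_measurable \<nu>"
    by measurable
  have "AE x in \<nu>. ?I x \<noteq> \<infinity>"
    using I by (intro nn_integral_PInf_AE) auto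
  then have powr_int: "AE x in \<nu>. integrable (K x) (\<lambda>y. norm (f y) powr p)"
    by (rule AE_mp) (auto intro!: AE_I2 integrableI_bounded simp: less_top sets_K
        cong: measurable_cong_sets)
  then show "AE x in \<nu>. integrable (K x) f"
    by (rule AE_mp) (auto intro!: AE_I2 prob_space.integrable_if_norm_powr_integrable[OF prob_space_K _ p]
        simp: sets_K cong: measurable_cong_sets)
  from powr_int have "AE x in \<nu>. ennreal (norm (\<integral>y. f y \<partial>K x) powr p) \<le> ?I x"
  proof (rule AE_mp, intro AE_I2 impI)
    fix x assume x: "x \<in> space \<nu>" and i: "integrable (K x) (\<lambda>y. norm (f y) powr p)"
    have "f \<in> borel_measurable (K x)"
      using assms(1) x by (simp add: sets_K cong: measurable_cong_sets)
    then have "norm (\<integral>y. f y \<partial>K x) powr p \<le> (\<integral>y. norm (f y) powr p \<partial>K x)"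
      by (rule prob_space.norm_integral_powr_le[OF prob_space_K[OF x] _ p i])
    then show "ennreal (norm (\<integral>y. f y \<partial>K x) powr p) \<le> ?I x"
      using i by (simp add: nn_integral_eq_integral)
  qed
  \<comment> \<open>The comparison is made between nonnegative integrals first: its finite
    right-hand side supplies the integrability that the Bochner version below presupposes.\<close>
  then have le: "(\<integral>\<^sup>+x. ennreal (norm (\<integral>y. f y \<partial>K x) powr p) \<partial>\<nu>)
      \<le> ennreal (\<integral>y. norm (f y) powr p \<partial>(\<nu> \<bind> K))"
    unfolding I[symmetric] by (rule nn_integral_mono_AE)
  show int': "integrable \<nu> (\<lambda>x. norm (\<integral>y. f y \<partial>K x) powr p)"
    using le by (intro integrableI_bounded) (auto intro: le_less_trans)
  show "(\<integral>x. norm (\<integral>y. f y \<partial>K x) powr p \<partial>\<nu>) \<le> (\<integral>y. norm (f y) powr p \<partial>(\<nu> \<bind> K))"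
    using le int' by (simp add: nn_integral_eq_integral)
qed

text \<open>The finite essential supremum \<open>c\<close> is itself an almost sure bound.
  \<open>AE_bind_K\<close> hands it to almost every component, and averaging over a probability
  measure preserves it.\<close>

lemma L_infinity:
  fixes f :: "'b \<Rightarrow> 'k::{banach,second_countable_topology}"
  assumes f[measurable]: "f \<in> borel_measurable N"
    and fin: "esssup (\<nu> \<bind> K) (\<lambda>y. ennreal (norm (f y))) < \<infinity>"
  shows "AE x in \<nu>. integrable (K x) f"
    and "esssup \<nu> (\<lambda>x. ennreal (norm (\<integral>y. f y \<partial>K x)))
      \<le> esssup (\<nu> \<bind> K) (\<lambda>y. ennreal (norm (f y)))"
proof -
  obtain c where c: "0 \<le> c" "esssup (\<nu> \<bind> K) (\<lambda>y. ennreal (norm (f y))) = ennreal c"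
    using fin by (cases "esssup (\<nu> \<bind> K) (\<lambda>y. ennreal (norm (f y)))") auto
  have "AE y in \<nu> \<bind> K. ennreal (norm (f y)) \<le> ennreal c"
    using esssup_AE[of "\<lambda>y. ennreal (norm (f y))" "\<nu> \<bind> K"] unfolding c .
  then have "AE y in \<nu> \<bind> K. norm (f y) \<le> c"
    using c(1) by simp
  then have bound: "AE x in \<nu>. AE y in K x. norm (f y) \<le> c"
    by (subst (asm) AE_bind_K) auto
  then have *: "AE x in \<nu>. integrable (K x) f \<and> norm (\<integral>y. f y \<partial>K x) \<le> c"
  proof (rule AE_mp, intro AE_I2 impI)
    fix x assume x: "x \<in> space \<nu>" and b: "AE y in K x. norm (f y) \<le> c"
    interpret Kx: prob_space "K x"
      using x by (rule prob_space_K)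
    have "f \<in> borel_measurable (K x)"
      using f x by (simp add: sets_K cong: measurable_cong_sets)
    then have i: "integrable (K x) f"
      using b by (rule Kx.integrable_const_bound[rotated])
    have "norm (\<integral>y. f y \<partial>K x) \<le> (\<integral>y. norm (f y) \<partial>K x)"
      by simp
    also have "\<dots> \<le> c"
      using i b by (intro Kx.integral_le_const) auto
    finally show "integrable (K x) f \<and> norm (\<integral>y. f y \<partial>K x) \<le> c"
      using i by simp
  qed
  then show "AE x in \<nu>. integrable (K x) f"
    by (rule AE_mp) simp
  show "esssup \<nu> (\<lambda>x. ennreal (norm (\<integral>y. f y \<partial>K x)))
      \<le> esssup (\<nu> \<bind> K) (\<lambda>y. ennreal (norm (f y)))"
    unfolding c using * by (intro esssup_I) (auto intro: ennreal_leI)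
qed

lemma Lp_contraction:
  fixes f :: "'b \<Rightarrow> 'k::{banach,second_countable_topology}"
  assumes p: "1 \<le> p" and f: "f \<in> Lp_space p (\<nu> \<bind> K)"
  shows "AE x in \<nu>. integrable (K x) f"
    and "(\<lambda>x. \<integral>y. f y \<partial>K x) \<in> Lp_space p \<nu>"
    and "Lp_norm p \<nu> (\<lambda>x. \<integral>y. f y \<partial>K x) \<le> Lp_norm p (\<nu> \<bind> K) f"
proof -
  have m: "f \<in> borel_measurable N"
    using f by (simp add: Lp_space_def sets_bind_K cong: measurable_cong_sets)
  have "(AE x in \<nu>. integrable (K x) f) \<and> (\<lambda>x. \<integral>y. f y \<partial>K x) \<in> Lp_space p \<nu>
    \<and> Lp_norm p \<nu> (\<lambda>x. \<integral>y. f y \<partial>K x) \<le> Lp_norm p (\<nu> \<bind> K) f"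
  proof (cases "p = \<infinity>")
    case True
    then have fin: "esssup (\<nu> \<bind> K) (\<lambda>y. ennreal (norm (f y))) < \<infinity>"
      using f by (simp add: Lp_space_def)
    show ?thesis
      using L_infinity[OF m fin] fin True integral_K_measurable[OF m]
      by (auto simp: Lp_space_def Lp_norm_def intro: enn2real_mono le_less_trans)
  next
    case False
    \<comment> \<open>Finiteness of \<open>p\<close> matters here, since \<open>enn2real\<close>
      sends \<infinity> to 0.\<close>
    then have p': "1 \<le> enn2real p"
      using p enn2real_mono[of 1 p] by (simp add: less_top)
    have int: "integrable (\<nu> \<bind> K) (\<lambda>y. norm (f y) powr enn2real p)"
      using f False by (simp add: Lp_space_def)
    show ?thesis
      using Lp_finite[OF m p' int] False integral_K_measurable[OF m] p'
      \<comment> \<open>Taking the root with exponent \<open>1 / enn2real p\<close> is monotone on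
        nonnegative integrals and turns the integral inequality into one between norms.\<close>
      by (auto simp: Lp_space_def Lp_norm_def intro!: powr_mono2 integral_nonneg_AE)
  qed
  then show "AE x in \<nu>. integrable (K x) f" "(\<lambda>x. \<integral>y. f y \<partial>K x) \<in> Lp_space p \<nu>"
    "Lp_norm p \<nu> (\<lambda>x. \<integral>y. f y \<partial>K x) \<le> Lp_norm p (\<nu> \<bind> K) f"
    by auto
qed

text \<open>This makes the operator well defined on equivalence classes: a null set of the mixture
  is null for almost every component.\<close>

lemma integral_K_cong_AE:
  fixes f g :: "'b \<Rightarrow> 'k::{banach,second_countable_topology}"
  assumes [measurable]: "f \<in> borel_measurable N" "g \<in> borel_measurable N"
    and "AE y in \<nu> \<bind> K. f y = g y"
  shows "AE x in \<nu>. (\<integral>y. f y \<partial>K x) = (\<integral>y. g y \<partial>K x)"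
proof -
  have "AE x in \<nu>. AE y in K x. f y = g y"
    using assms(3) by (subst (asm) AE_bind_K) auto
  then show ?thesis
    by (rule AE_mp) (auto intro!: AE_I2 integral_cong_AE simp: sets_K cong: measurable_cong_sets)
qed

end

section \<open>Heat kernel measures\<close>

text \<open>The manifold is open in its compactification, so open sets have open images, and
  induction over the generated sigma-algebra gives the rest.\<close>

lemma Some_image_borel_compactified:
  assumes "E \<in> sets borel"
  shows "Some ` E \<in> sets borel_compactified"
proof -
  have sets: "sets borel_compactified = sigma_sets UNIV {U. openin compactified U}"
    by (simp add: borel_compactified_def)
  have op: "Some ` U \<in> sets borel_compactified" if "open U" for U :: "'a set"
    unfolding sets using that by (intro sigma_sets.Basic) simp
  from assms have "E \<in> sigma_sets UNIV {S. open S}"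
    by (simp add: borel_def)
  then show ?thesis
  proof induction
    case (Compl A)
    \<comment> \<open>The complement is taken within the manifold, so the added point must stay
      excluded.\<close>
    have "Some ` (UNIV - A) = Some ` UNIV - Some ` A"
      by auto
    then show ?case
      using Compl.IH op[of UNIV] by auto
  qed (auto simp: op image_UN)
qed

context diffusion
begin

lemma event_measurable:
  assumes "0 \<le> t" and "E \<in> sets borel"
  shows "{\<omega> \<in> \<Omega>. X t \<omega> \<in> Some ` E} \<in> sets (F (ennreal t))"
    and "{\<omega> \<in> \<Omega>. X t \<omega> \<in> Some ` E} \<in> sets (P x)"
proof -
  have "X t -` (Some ` E) \<inter> space (F (ennreal t)) = {\<omega> \<in> \<Omega>. X t \<omega> \<in> Some ` E}"
    using filtration.space_F[OF filtration] by auto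
  then show "{\<omega> \<in> \<Omega>. X t \<omega> \<in> Some ` E} \<in> sets (F (ennreal t))"
    using measurable_sets[OF adapted[OF assms(1)] Some_image_borel_compactified[OF assms(2)]] by simp
  then show "{\<omega> \<in> \<Omega>. X t \<omega> \<in> Some ` E} \<in> sets (P x)"
    using subalgebra[of x "ennreal t"] by (auto simp: subalgebra_def)
qed

lemma sets_heat_kernel[simp, measurable_cong]: "sets (heat_kernel P X t x) = sets borel"
  using sets.sigma_sets_eq[of borel] by (simp add: heat_kernel_def sets_measure_of_conv)

lemma space_heat_kernel[simp]: "space (heat_kernel P X t x) = UNIV"
  using sets_eq_imp_space_eq[OF sets_heat_kernel] by simp

text \<open>\<open>measure_of\<close> returns the prescribed set function only if that function is a
  measure. Countable additivity comes from disjoint Borel sets giving disjoint events.\<close>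

lemma emeasure_heat_kernel:
  assumes t: "0 \<le> t" and E: "E \<in> sets borel"
  shows "emeasure (heat_kernel P X t x) E = emeasure (P x) {\<omega> \<in> \<Omega>. X t \<omega> \<in> Some ` E}"
proof -
  have "countably_additive (sets (heat_kernel P X t x)) (\<lambda>E. emeasure (P x) {\<omega>\<in>space (P x). X t \<omega> \<in> Some ` E})"
  proof (rule countably_additiveI)
    fix A :: "nat \<Rightarrow> 'm set"
    assume A: "range A \<subseteq> sets (heat_kernel P X t x)" "disjoint_family A"
    have "(\<Sum>i. emeasure (P x) {\<omega> \<in> space (P x). X t \<omega> \<in> Some ` A i})
        = emeasure (P x) (\<Union>i. {\<omega> \<in> space (P x). X t \<omega> \<in> Some ` A i})"
      using A event_measurable(2)[OF t]
      by (intro suminf_emeasure) (auto simp: disjoint_family_on_def disjoint_iff space_P)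
    also have "(\<Union>i. {\<omega> \<in> space (P x). X t \<omega> \<in> Some ` A i}) = {\<omega> \<in> space (P x). X t \<omega> \<in> Some ` (\<Union>i. A i)}"
      by auto
    finally show "(\<Sum>i. emeasure (P x) {\<omega> \<in> space (P x). X t \<omega> \<in> Some ` A i})
        = emeasure (P x) {\<omega> \<in> space (P x). X t \<omega> \<in> Some ` (\<Union>i. A i)}" .
  qed
  then have "emeasure (heat_kernel P X t x) E = emeasure (P x) {\<omega>\<in>space (P x). X t \<omega> \<in> Some ` E}"
    using E by (intro emeasure_measure_of[OF heat_kernel_def]) (auto simp: positive_def)
  then show ?thesis
    by (simp add: space_P)
qed

lemma the_X_measurable[measurable]:
  assumes "0 \<le> t"
  shows "(\<lambda>\<omega>. the (X t \<omega>)) \<in> P x \<rightarrow>\<^sub>M borel"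
proof (rule measurableI)
  fix E :: "'m set"
  assume E: "E \<in> sets borel"
  \<comment> \<open>All paths that have left the manifold are sent to the single value
    \<open>the None\<close>, so they enter the preimage together or not at all.\<close>
  have "(\<lambda>\<omega>. the (X t \<omega>)) -` E \<inter> space (P x) =
    {\<omega> \<in> \<Omega>. X t \<omega> \<in> Some ` E} \<union>
    (if the None \<in> E then space (P x) - {\<omega> \<in> \<Omega>. X t \<omega> \<in> Some ` UNIV} else {})"
  proof (rule set_eqI)
    fix \<omega>
    show "\<omega> \<in> (\<lambda>\<omega>. the (X t \<omega>)) -` E \<inter> space (P x) \<longleftrightarrow>
      \<omega> \<in> {\<omega> \<in> \<Omega>. X t \<omega> \<in> Some ` E} \<union>
        (if the None \<in> E then space (P x) - {\<omega> \<in> \<Omega>. X t \<omega> \<in> Some ` UNIV} else {})"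
      by (cases "X t \<omega>") (auto simp: space_P)
  qed
  also have "\<dots> \<in> sets (P x)"
    using event_measurable(2)[OF assms E, of x] event_measurable(2)[OF assms, of UNIV x] by auto
  finally show "(\<lambda>\<omega>. the (X t \<omega>)) -` E \<inter> space (P x) \<in> sets (P x)" .
qed simp

text \<open>The junk value \<^term>\<open>the None\<close> is harmless, being taken on a null set only.\<close>

lemma heat_kernel_eq_distr:
  assumes t: "0 \<le> t" and x: "AE \<omega> in P x. X t \<omega> \<in> range Some"
  shows "heat_kernel P X t x = distr (P x) borel (\<lambda>\<omega>. the (X t \<omega>))"
proof (rule measure_eqI)
  fix E
  assume "E \<in> sets (heat_kernel P X t x)"
  then have E: "E \<in> sets borel"
    by simp
  have "emeasure (P x) {\<omega> \<in> \<Omega>. X t \<omega> \<in> Some ` E}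
      = emeasure (P x) ((\<lambda>\<omega>. the (X t \<omega>)) -` E \<inter> space (P x))"
  proof (rule emeasure_eq_AE)
    from x show "AE \<omega> in P x. \<omega> \<in> {\<omega> \<in> \<Omega>. X t \<omega> \<in> Some ` E} \<longleftrightarrow>
        \<omega> \<in> (\<lambda>\<omega>. the (X t \<omega>)) -` E \<inter> space (P x)"
      by eventually_elim (auto simp: space_P)
  qed (use measurable_sets[OF the_X_measurable[OF t] E] event_measurable(2)[OF t E] in auto)
  then show "emeasure (heat_kernel P X t x) E = emeasure (distr (P x) borel (\<lambda>\<omega>. the (X t \<omega>))) E"
    using emeasure_heat_kernel[OF t E] the_X_measurable[OF t] E by (simp add: emeasure_distr)
qed simp

lemma prob_space_heat_kernel:
  assumes "0 \<le> t" and "AE \<omega> in P x. X t \<omega> \<in> range Some"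
  shows "prob_space (heat_kernel P X t x)"
  unfolding heat_kernel_eq_distr[OF assms]
  using prob_space.prob_space_distr[OF prob_space_P the_X_measurable[OF assms(1)]] .

text \<open>Intersecting an event of the stopped sigma-algebra with the sure event
  \<open>c \<le> c\<close> shows that it lies in \<open>F c\<close>. Conditional expectations at a
  constant time are thereby available.\<close>

lemma subalgebra_pre_sigma_const: "subalgebra (P x) (filtration.pre_sigma \<Omega> F (\<lambda>_. c))"
proof -
  have "A \<in> sets (F c)" if "A \<in> sets (filtration.pre_sigma \<Omega> F (\<lambda>_. c))" for A
    using filtration.sets_pre_sigmaD[OF filtration stopping_time_const that, of c] by simp
  then show ?thesis
    using subalgebra[of x c]
    by (auto simp: subalgebra_def filtration.space_pre_sigma[OF filtration] space_P)
qed

text \<open>The strong Markov property at the constant time \<open>s\<close> identifies the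
  conditional probability of the later event with the kernel at \<open>X s\<close>; taking
  expectations removes the conditioning.\<close>

lemma chapman_kolmogorov:
  assumes s: "0 \<le> s" and t: "0 \<le> t" and E: "E \<in> sets borel"
    and x: "AE \<omega> in P x. X s \<omega> \<in> range Some"
    and meas: "(\<lambda>y. emeasure (heat_kernel P X t y) E) \<in> borel_measurable borel"
  shows "emeasure (heat_kernel P X (s + t) x) E
    = (\<integral>\<^sup>+y. emeasure (heat_kernel P X t y) E \<partial>heat_kernel P X s x)"
proof -
  let ?G = "filtration.pre_sigma \<Omega> F (\<lambda>_. ennreal s)"
  let ?A = "{\<omega> \<in> \<Omega>. X (s + t) \<omega> \<in> Some ` E}"
  let ?c = "real_cond_exp (P x) ?G (indicator ?A)"
  interpret Px: prob_space "P x"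
    by (rule prob_space_P)
  interpret G: finite_measure_subalgebra "P x" ?G
    by unfold_locales (rule subalgebra_pre_sigma_const)
  have A: "?A \<in> sets (P x)"
    using event_measurable(2) s t E by simp
  have iA: "integrable (P x) (indicator ?A :: 'w \<Rightarrow> real)"
    using A by (intro integrable_real_indicator) (auto simp: Px.emeasure_eq_measure)
  have "AE \<omega> in P x. \<forall>y. X s \<omega> = Some y \<longrightarrow>
      ?c \<omega> = measure (P y) {\<omega> \<in> \<Omega>. X t \<omega> \<in> Some ` E}"
    using strong_markov[OF stopping_time_const[of F "ennreal s"] t E, of x] s by simp
  \<comment> \<open>Almost surely the process is still in the manifold at time \<open>s\<close>, so
    the universally quantified \<open>y\<close> can be instantiated with
    \<open>the (X s \<omega>)\<close>.\<close>
  with x have c: "AE \<omega> in P x. ?c \<omega> = measure (P (the (X s \<omega>))) {\<omega>' \<in> \<Omega>. X t \<omega>' \<in> Some ` E}"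
    by eventually_elim auto
  have "emeasure (heat_kernel P X (s + t) x) E = ennreal (\<integral>\<omega>. indicator ?A \<omega> \<partial>P x)"
    using emeasure_heat_kernel[of "s + t" E x] s t E A by (simp add: Px.emeasure_eq_measure)
  also have "\<dots> = ennreal (\<integral>\<omega>. ?c \<omega> \<partial>P x)"
    using G.real_cond_exp_int(2)[OF iA] by simp
  \<comment> \<open>The conditional expectation is nonnegative almost surely, because by
    \<open>c\<close> it equals a measure.\<close>
  also have "\<dots> = (\<integral>\<^sup>+\<omega>. ennreal (?c \<omega>) \<partial>P x)"
    using G.real_cond_exp_int(1)[OF iA] c by (intro nn_integral_eq_integral[symmetric]) auto
  also have "\<dots> = (\<integral>\<^sup>+\<omega>. emeasure (heat_kernel P X t (the (X s \<omega>))) E \<partial>P x)"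
    using c
    by (intro nn_integral_cong_AE) (auto simp: emeasure_heat_kernel[OF t E]
        finite_measure.emeasure_eq_measure[OF prob_space.finite_measure[OF prob_space_P]])
  also have "\<dots> = (\<integral>\<^sup>+y. emeasure (heat_kernel P X t y) E \<partial>heat_kernel P X s x)"
    unfolding heat_kernel_eq_distr[OF s x]
    using the_X_measurable[OF s] meas by (simp add: nn_integral_distr)
  finally show ?thesis .
qed

end

section \<open>Contraction property of the heat operator\<close>

theorem theorem1p1:
  fixes atlas :: "('m::{t2_space,second_countable_topology}, 'e::real_normed_vector) chart set"
    and L :: "('m \<Rightarrow> real) \<Rightarrow> 'm \<Rightarrow> real"
    and \<Omega> :: "'w set"
    and F :: "ennreal \<Rightarrow> 'w measure"
    and P :: "'m \<Rightarrow> 'w measure"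
    and X :: "real \<Rightarrow> 'w \<Rightarrow> 'm option"
    and x0 :: 'm and t T :: real and p :: ennreal
  assumes diffusion: "diffusion atlas L \<Omega> F P X"
    and stochastically_complete:
      "\<forall>x. \<forall>s\<ge>0. measure (P x) {\<omega>\<in>space (P x). X s \<omega> \<in> range Some} = 1"
    and measurable_kernel:
      "\<forall>s\<ge>0. \<forall>E\<in>sets borel. (\<lambda>x. emeasure (heat_kernel P X s x) E) \<in> borel_measurable borel"
    and "0 \<le> t" and "t < T" and "1 \<le> p"
  shows
    "(\<forall>f :: 'm \<Rightarrow> 'k::{real_normed_field,banach,second_countable_topology}.
        f \<in> Lp_space p (heat_kernel P X T x0) \<longrightarrow>
          (AE x in heat_kernel P X (T - t) x0. integrable (heat_kernel P X t x) f) \<and>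
          heat_operator P X t f \<in> Lp_space p (heat_kernel P X (T - t) x0) \<and>
          Lp_norm p (heat_kernel P X (T - t) x0) (heat_operator P X t f)
            \<le> Lp_norm p (heat_kernel P X T x0) f) \<and>
     (\<forall>f g :: 'm \<Rightarrow> 'k.
        f \<in> Lp_space p (heat_kernel P X T x0) \<and> g \<in> Lp_space p (heat_kernel P X T x0) \<longrightarrow>
          ((AE y in heat_kernel P X T x0. f y = g y) \<longrightarrow>
            (AE x in heat_kernel P X (T - t) x0.
               heat_operator P X t f x = heat_operator P X t g x)) \<and>
          (\<forall>a b :: 'k. AE x in heat_kernel P X (T - t) x0.
             heat_operator P X t (\<lambda>y. a * f y + b * g y) x =
               a * heat_operator P X t f x + b * heat_operator P X t g x))"
proof -
  interpret diffusion atlas L \<Omega> F P X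
    by (rule diffusion)
  have in_M: "AE \<omega> in P x. X s \<omega> \<in> range Some" if "0 \<le> s" for s x
  proof -
    interpret Px: prob_space "P x"
      by (rule prob_space_P)
    have "{\<omega> \<in> space (P x). X s \<omega> \<in> range Some} \<in> sets (P x)"
      using event_measurable(2)[OF that, of UNIV x] by (simp add: space_P)
    then show ?thesis
      using stochastically_complete that by (subst Px.AE_iff_emeasure_eq_1) (auto simp: Px.emeasure_eq_measure)
  qed
  have Tt: "0 \<le> T - t"
    using \<open>t < T\<close> by simp
  interpret \<nu>: prob_space "heat_kernel P X (T - t) x0"
    by (rule prob_space_heat_kernel[OF Tt in_M[OF Tt]])
  \<comment> \<open>The assumed measurability for each Borel set is exactly what makes the kernel a
    measurable map into the space of measures.\<close>
  have "heat_kernel P X t \<in> borel \<rightarrow>\<^sub>M subprob_algebra borel"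
    using measurable_kernel \<open>0 \<le> t\<close> prob_space_heat_kernel[OF \<open>0 \<le> t\<close> in_M]
    by (intro measurable_subprob_algebra) (auto intro: prob_space_imp_subprob_space)
  then have "heat_kernel P X t \<in> borel \<rightarrow>\<^sub>M prob_algebra borel"
    using prob_space_heat_kernel[OF \<open>0 \<le> t\<close> in_M] \<open>0 \<le> t\<close> by (intro measurable_prob_algebraI) auto
  then interpret markov_kernel_on "heat_kernel P X (T - t) x0" "heat_kernel P X t" borel
    by unfold_locales (simp cong: measurable_cong_sets)
  \<comment> \<open>On each Borel set both sides equal the same integral, by Chapman-Kolmogorov with
    \<open>T = (T - t) + t\<close>.\<close>
  have semigroup: "heat_kernel P X T x0 = heat_kernel P X (T - t) x0 \<bind> heat_kernel P X t"
  proof (rule measure_eqI)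
    fix E
    assume "E \<in> sets (heat_kernel P X T x0)"
    then show "emeasure (heat_kernel P X T x0) E
        = emeasure (heat_kernel P X (T - t) x0 \<bind> heat_kernel P X t) E"
      using chapman_kolmogorov[OF Tt \<open>0 \<le> t\<close> _ in_M[OF Tt], of E x0] measurable_kernel \<open>0 \<le> t\<close>
        emeasure_bind[OF \<nu>.not_empty K_subprob, of E] by simp
  qed (simp add: sets_bind_K)
  have meas: "f \<in> borel_measurable borel" if "f \<in> Lp_space p (heat_kernel P X T x0)" for f :: "'m \<Rightarrow> 'k"
    using that by (simp add: Lp_space_def cong: measurable_cong_sets)
  have operator: "heat_operator P X t f = (\<lambda>x. \<integral>y. f y \<partial>heat_kernel P X t x)" for f :: "'m \<Rightarrow> 'k"
    by (simp add: heat_operator_def fun_eq_iff)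
  show ?thesis
  proof (intro conjI allI impI; (elim conjE)?)
    fix f :: "'m \<Rightarrow> 'k"
    assume f: "f \<in> Lp_space p (heat_kernel P X T x0)"
    note contraction = Lp_contraction[OF \<open>1 \<le> p\<close> f[unfolded semigroup], folded semigroup operator]
    show "AE x in heat_kernel P X (T - t) x0. integrable (heat_kernel P X t x) f"
      by (rule contraction)
    show "heat_operator P X t f \<in> Lp_space p (heat_kernel P X (T - t) x0)"
      by (rule contraction)
    show "Lp_norm p (heat_kernel P X (T - t) x0) (heat_operator P X t f) \<le> Lp_norm p (heat_kernel P X T x0) f"
      by (rule contraction)
  next
    fix f g :: "'m \<Rightarrow> 'k"
    assume f: "f \<in> Lp_space p (heat_kernel P X T x0)"
      and g: "g \<in> Lp_space p (heat_kernel P X T x0)"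
    show "AE x in heat_kernel P X (T - t) x0. heat_operator P X t f x = heat_operator P X t g x"
      if "AE y in heat_kernel P X T x0. f y = g y"
      unfolding operator using integral_K_cong_AE[OF meas[OF f] meas[OF g]] that unfolding semigroup .
    fix a b :: 'k
    show "AE x in heat_kernel P X (T - t) x0. heat_operator P X t (\<lambda>y. a * f y + b * g y) x =
        a * heat_operator P X t f x + b * heat_operator P X t g x"
      \<comment> \<open>The Bochner integral of a non-integrable function is 0 by convention, so
        additivity is invoked only at points where both \<open>f\<close> and \<open>g\<close> are
        integrable; these are almost all points.\<close>
      using Lp_contraction(1)[OF \<open>1 \<le> p\<close> f[unfolded semigroup]]
        Lp_contraction(1)[OF \<open>1 \<le> p\<close> g[unfolded semigroup]]
      unfolding operator by eventually_elim simp
  qed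
qed

end
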